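(* Let $n\ge 2$ and $\delta\in\{\mathrm{I},\mathrm{D},\mathrm{U},\mathrm{X}\}^n$. The convex hull in $\mathbb{R}^{n-1}$ of the cubic vectors $\vec c(T)$ of all $\delta$-permutrees $T$ on $n$ nodes is normally equivalent to (has the same normal fan as) the standard cube $[0,1]^{n-1}$.
   Context: Decorations: $\mathrm{I}$ (one parent, one child), $\mathrm{D}$ (one parent, two children), $\mathrm{U}$ (two parents, one child), $\mathrm{X}$ (two parents, two children). A $\delta$-permutree is a directed tree on nodes $v_1,\dots,v_n$ (with dangling leaf/root edges allowed, so a neighbour slot may be empty) in which $v_i$ has two parent slots if $\delta_i\in\{\mathrm{U},\mathrm{X}\}$ and one otherwise, and two child slots if $\delta_i\in\{\mathrm{D},\mathrm{X}\}$ and one otherwise. Removing $v_i$, each slot determines a (possibly empty) subtree, consisting of the nodes in the connected component reached through that slot; when there are two child slots the left descendant subtree $LD_i$ has all labels $<i$ and the right descendant subtree $RD_i$ all labels $>i$ (similarly for two parents). If $v_i$ has one child slot, $D_i$ denotes its descendant subtree. The cubic set of $T$ is $C(T):=\{(i,j): i<j \text{ and } v_j\in D_i\}$ for those $i$ with $\delta_i\in\{\mathrm{I},\mathrm{U}\}$, together with $\{(i,j): v_j\in RD_i\}$ for those $i$ with $\delta_i\in\{\mathrm{D},\mathrm{X}\}$. Its components are $C(T)_i=\{j:(i,j)\in C(T)\}$ and the cubic vector is $\vec c(T)=(c_1,\dots,c_{n-1})$ with $c_i=|C(T)_i|$. *)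

theory Defs
  imports "HOL-Analysis.Analysis"
begin

section \<open>Permutrees\<close>

datatype decoration = DecI | DecD | DecU | DecX

datatype side = Only | Left | Right

datatype slot = Parent side | Child side

definition slots :: "decoration \<Rightarrow> slot set" where
  "slots d =
     (if d \<in> {DecU, DecX} then {Parent Left, Parent Right} else {Parent Only}) \<union>
     (if d \<in> {DecD, DecX} then {Child Left, Child Right} else {Child Only})"

text \<open>
  The node \<open>v\<^sub>i\<close> is identified with its label \<open>i\<close>. A tree is given by the contents of the
  slots of its nodes: \<open>T i s = Some j\<close> if the slot \<open>s\<close> of node \<open>i\<close> holds the neighbour \<open>j\<close>, and
  \<open>T i s = None\<close> if that slot carries a dangling edge or does not exist.
\<close>

type_synonym slotted_tree = "nat \<Rightarrow> slot \<Rightarrow> nat option"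

definition adj :: "slotted_tree \<Rightarrow> (nat \<times> nat) set" where
  "adj T = {(i, j). \<exists>s. T i s = Some j}"

definition is_cycle :: "slotted_tree \<Rightarrow> nat list \<Rightarrow> bool" where
  "is_cycle T p \<longleftrightarrow> 3 \<le> length p \<and> distinct p \<and>
     (\<forall>k < length p. (p ! k, p ! (Suc k mod length p)) \<in> adj T)"

text \<open>
  The first clause says that only existing slots are used. The second says that a directed edge
  leaves its upper end through a child slot and enters its lower end through a parent slot.
  The third excludes loops (which would occupy both a parent and a child slot) and multiple or
  opposite edges, which \<open>is_cycle\<close> does not see. The last two say that the underlying
  undirected graph is a tree.
\<close>

definition directed_tree_on :: "nat set \<Rightarrow> (nat \<Rightarrow> decoration) \<Rightarrow> slotted_tree \<Rightarrow> bool" where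
  "directed_tree_on V \<delta> T \<longleftrightarrow>
     (\<forall>i s j. T i s = Some j \<longrightarrow> i \<in> V \<and> j \<in> V \<and> s \<in> slots (\<delta> i)) \<and>
     (\<forall>i j. (\<exists>a. T i (Child a) = Some j) \<longleftrightarrow> (\<exists>b. T j (Parent b) = Some i)) \<and>
     (\<forall>i s t j. T i s = Some j \<and> T i t = Some j \<longrightarrow> s = t) \<and>
     (\<forall>i\<in>V. \<forall>j\<in>V. (i, j) \<in> (adj T)\<^sup>*) \<and>
     (\<nexists>p. is_cycle T p)"

text \<open>
  The nodes of the connected component of \<open>T\<close> without \<open>i\<close> that is reached through slot \<open>s\<close>
  of \<open>i\<close>. Paths inside this component may go both up and down.
\<close>

definition subtree :: "slotted_tree \<Rightarrow> nat \<Rightarrow> slot \<Rightarrow> nat set" where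
  "subtree T i s = {j. \<exists>k. T i s = Some k \<and> (k, j) \<in> {(a, b) \<in> adj T. a \<noteq> i \<and> b \<noteq> i}\<^sup>*}"

definition permutree_on :: "nat set \<Rightarrow> (nat \<Rightarrow> decoration) \<Rightarrow> slotted_tree \<Rightarrow> bool" where
  "permutree_on V \<delta> T \<longleftrightarrow> directed_tree_on V \<delta> T \<and>
     (\<forall>i\<in>V. subtree T i (Child Left) \<subseteq> {..<i} \<and> subtree T i (Child Right) \<subseteq> {i<..} \<and>
             subtree T i (Parent Left) \<subseteq> {..<i} \<and> subtree T i (Parent Right) \<subseteq> {i<..})"

definition permutrees :: "nat \<Rightarrow> (nat \<Rightarrow> decoration) \<Rightarrow> slotted_tree set" where
  "permutrees n \<delta> = {T. permutree_on {1..n} \<delta> T}"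


section \<open>Cubic vectors\<close>

definition cubic_set :: "nat \<Rightarrow> (nat \<Rightarrow> decoration) \<Rightarrow> slotted_tree \<Rightarrow> (nat \<times> nat) set" where
  "cubic_set n \<delta> T =
     {(i, j). i \<in> {1..n} \<and> \<delta> i \<in> {DecI, DecU} \<and> i < j \<and> j \<in> subtree T i (Child Only)} \<union>
     {(i, j). i \<in> {1..n} \<and> \<delta> i \<in> {DecD, DecX} \<and> j \<in> subtree T i (Child Right)}"

text \<open>
  \<open>idx\<close> is the numbering of the coordinates of \<open>real ^ 'm\<close> by \<open>1, \<dots>, n - 1\<close>.
\<close>

definition cubic_vector ::
    "nat \<Rightarrow> (nat \<Rightarrow> decoration) \<Rightarrow> ('m::finite \<Rightarrow> nat) \<Rightarrow> slotted_tree \<Rightarrow> real ^ 'm" where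
  "cubic_vector n \<delta> idx T = (\<chi> k. real (card (cubic_set n \<delta> T `` {idx k})))"


section \<open>Normal fans of polytopes\<close>

definition normal_cone :: "'a::real_inner set \<Rightarrow> 'a set \<Rightarrow> 'a set" where
  "normal_cone P F = {u. \<forall>x\<in>F. \<forall>y\<in>P. u \<bullet> y \<le> u \<bullet> x}"

definition normal_fan :: "'a::real_inner set \<Rightarrow> 'a set set" where
  "normal_fan P = {normal_cone P F | F. F face_of P \<and> F \<noteq> {}}"

definition normally_equivalent :: "'a::real_inner set \<Rightarrow> 'a set \<Rightarrow> bool" where
  "normally_equivalent P Q \<longleftrightarrow> normal_fan P = normal_fan Q"

end

theory Submission
  imports Defs
begin

text \<open>
  All cubic vectors lie in the box of the points \<open>x\<close> with \<open>0 \<le> x\<^sub>i \<le> n - i\<close>, and every vertex of this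
  box is a cubic vector: given a set \<open>S\<close> of labels, insert the nodes in the order \<open>n, n - 1, \<dots>, 1\<close>,
  hanging all larger nodes below node \<open>i\<close> if \<open>i \<in> S\<close> and above node \<open>i\<close> otherwise. This is always
  possible, because the tree built so far keeps a dangling child edge and a dangling parent edge that
  are to the right of no node. So the convex hull is the image of the cube under a positive diagonal
  map, and such maps preserve the normal fan of the cube.
\<close>

section \<open>Attaching a node to a directed tree\<close>

lemma adjI: "T i s = Some j \<Longrightarrow> (i, j) \<in> adj T"
  by (auto simp: adj_def)

lemma subtree_subset:
  assumes "directed_tree_on V \<delta> T"
  shows "subtree T i s \<subseteq> V"
proof
  fix j assume "j \<in> subtree T i s"
  then obtain k where k: "T i s = Some k" "(k, j) \<in> {(a, b) \<in> adj T. a \<noteq> i \<and> b \<noteq> i}\<^sup>*"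
    by (auto simp: subtree_def)
  from k(2) show "j \<in> V"
  proof (induction rule: rtrancl_induct)
    case base
    show ?case using assms k(1) unfolding directed_tree_on_def by blast
  next
    case (step y z)
    then show ?case using assms unfolding directed_tree_on_def adj_def by blast
  qed
qed

text \<open>The paths defining a subtree avoid \<open>i\<close>, so \<open>i\<close> could only be
  reached if it were its own neighbour. Such a loop would occupy both a child and a parent
  slot.\<close>

lemma subtree_irrefl:
  assumes "directed_tree_on V \<delta> T"
  shows "i \<notin> subtree T i s"
proof
  assume "i \<in> subtree T i s"
  then obtain k where k: "T i s = Some k" "(k, i) \<in> {(a, b) \<in> adj T. a \<noteq> i \<and> b \<noteq> i}\<^sup>*"
    by (auto simp: subtree_def)
  \<comment> \<open>No step of the restricted relation ends in \<open>i\<close>, so the path must be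
    empty.\<close>
  have "k = i" using k(2) by (cases rule: rtranclE) auto
  then have loop: "T i s = Some i" using k by simp
  have dual: "\<And>i j. (\<exists>a. T i (Child a) = Some j) \<longleftrightarrow> (\<exists>b. T j (Parent b) = Some i)"
    and simple: "\<And>s t j. T i s = Some j \<Longrightarrow> T i t = Some j \<Longrightarrow> s = t"
    using assms unfolding directed_tree_on_def by blast+
  obtain a b where "T i (Child a) = Some i" "T i (Parent b) = Some i"
    using loop dual[of i i] by (cases s) auto
  then show False using simple[of "Child a" i "Parent b"] by simp
qed

lemma subtree_None: "T i s = None \<Longrightarrow> subtree T i s = {}"
  by (simp add: subtree_def)

text \<open>Resetting all slots of \<open>i\<close> first makes it a leaf of the underlying graph.
  The new edge is recorded at both of its ends.\<close>

definition attach :: "nat \<Rightarrow> slot \<Rightarrow> nat \<Rightarrow> slot \<Rightarrow> slotted_tree \<Rightarrow> slotted_tree" where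
  "attach i s p t T = T(i := (\<lambda>_. None)(s := Some p), p := (T p)(t := Some i))"

text \<open>The assumption \<open>dir\<close> covers both orientations of the new edge, so hanging
  the old tree below or above \<open>i\<close> is treated at once.\<close>

locale attachment =
  fixes V :: "nat set" and \<delta> :: "nat \<Rightarrow> decoration" and T :: slotted_tree
    and i p :: nat and s t :: slot
  assumes tree: "directed_tree_on V \<delta> T"
    and new: "i \<notin> V" and old: "p \<in> V" and free: "T p t = None"
    and slots: "s \<in> slots (\<delta> i)" "t \<in> slots (\<delta> p)"
    and dir: "\<exists>a b. (s, t) \<in> {(Parent a, Child b), (Child a, Parent b)}"
begin

abbreviation "T' \<equiv> attach i s p t T"

lemma T_new: "T i u = None" and T_old: "T q u \<noteq> Some i"
proof -
  have "\<And>q u j. T q u = Some j \<Longrightarrow> q \<in> V \<and> j \<in> V"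
    using tree unfolding directed_tree_on_def by blast
  then show "T i u = None" "T q u \<noteq> Some i" using new by (cases "T i u"; blast)+
qed

lemma adj_new: "(i, q) \<notin> adj T" "(q, i) \<notin> adj T"
  using T_new T_old by (auto simp: adj_def)

lemma neq: "p \<noteq> i" using old new by auto

lemma attach_eq:
  "T' q u = (if q = i then if u = s then Some p else None
             else if q = p \<and> u = t then Some i else T q u)"
  using neq by (auto simp: attach_def)

lemma adj_attach: "adj T' = adj T \<union> {(i, p), (p, i)}"
proof -
  have "(a, b) \<in> adj T \<union> {(i, p), (p, i)}" if ab: "(a, b) \<in> adj T'" for a b
  proof -
    obtain u where "T' a u = Some b" using ab by (auto simp: adj_def)
    then show ?thesis by (auto simp: attach_eq split: if_splits intro: adjI)
  qed
  moreover have "(a, b) \<in> adj T'" if ab: "(a, b) \<in> adj T" for a b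
  proof -
    obtain u where "T a u = Some b" using ab by (auto simp: adj_def)
    then have "T' a u = Some b" using free T_new by (auto simp: attach_eq)
    then show ?thesis by (rule adjI)
  qed
  moreover have "(i, p) \<in> adj T'" "(p, i) \<in> adj T'"
    by (rule adjI[of _ _ s], simp add: attach_eq) (rule adjI[of _ _ t], use neq in \<open>simp add: attach_eq\<close>)
  ultimately show ?thesis by (auto simp del: Un_insert_right)
qed

section \<open>Attaching a leaf preserves directed trees\<close>

text \<open>The only neighbour of \<open>i\<close> is \<open>p\<close>. On a cycle through
  \<open>i\<close>, predecessor and successor would both be \<open>p\<close>, which is impossible
  for distinct nodes and length at least 3.\<close>

lemma no_cycle: "\<not> is_cycle T' c"
proof
  assume cyc: "is_cycle T' c"
  define l where "l = length c"
  have l: "3 \<le> l" and dist: "distinct c"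
    and edge: "\<And>k. k < l \<Longrightarrow> (c ! k, c ! (Suc k mod l)) \<in> adj T'"
    using cyc by (auto simp: is_cycle_def l_def)
  show False
  proof (cases "i \<in> set c")
    case False
    have "(c ! k, c ! (Suc k mod l)) \<in> adj T" if "k < l" for k
    proof -
      have "c ! k \<noteq> i" "c ! (Suc k mod l) \<noteq> i"
        using False that l unfolding l_def
        by (metis nth_mem, metis nth_mem mod_less_divisor less_le_trans zero_less_numeral)
      then show ?thesis using edge[OF that] by (auto simp: adj_attach)
    qed
    then have "is_cycle T c" using l dist by (auto simp: is_cycle_def l_def)
    then show False using tree by (auto simp: directed_tree_on_def)
  next
    case True
    then obtain k where k: "k < l" "c ! k = i" by (auto simp: in_set_conv_nth l_def)
    \<comment> \<open>The cyclic predecessor of \<open>k\<close>.\<close>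
    define k' where "k' = (if k = 0 then l - 1 else k - 1)"
    have k': "k' < l" "Suc k' mod l = k" using k l by (auto simp: k'_def)
    have "c ! (Suc k mod l) = p" using edge[OF k(1)] k(2) adj_new by (auto simp: adj_attach)
    moreover have "c ! k' = p" using edge[OF k'(1)] k'(2) k(2) adj_new by (auto simp: adj_attach)
    moreover have "Suc k mod l < l" using l by simp
    ultimately have "Suc k mod l = k'"
      using dist k'(1) by (metis l_def nth_eq_iff_index_eq)
    then show False using l k by (auto simp: k'_def mod_Suc split: if_splits)
  qed
qed

lemma directed_tree_attach: "directed_tree_on (insert i V) \<delta> T'"
proof -
  have in_V: "\<And>q u j. T q u = Some j \<Longrightarrow> q \<in> V \<and> j \<in> V \<and> u \<in> slots (\<delta> q)"
    and dual: "\<And>q j. (\<exists>a. T q (Child a) = Some j) \<longleftrightarrow> (\<exists>b. T j (Parent b) = Some q)"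
    and simple: "\<And>q u v j. T q u = Some j \<Longrightarrow> T q v = Some j \<Longrightarrow> u = v"
    and conn: "\<And>q j. q \<in> V \<Longrightarrow> j \<in> V \<Longrightarrow> (q, j) \<in> (adj T)\<^sup>*"
    using tree unfolding directed_tree_on_def by blast+
  have dual': "(\<exists>a. T' q (Child a) = Some j) \<longleftrightarrow> (\<exists>b. T' j (Parent b) = Some q)" for q j
  proof -
    \<comment> \<open>At \<open>i\<close> only the new edge matters, and \<open>dir\<close> gives it
      one child end and one parent end; elsewhere nothing changes.\<close>
    consider "q = i" | "j = i" | "q \<noteq> i" "j \<noteq> i" by blast
    then show ?thesis
    proof cases
      case 1
      show ?thesis unfolding 1 using dir neq by (auto simp: attach_eq T_new T_old)
    next
      case 2
      show ?thesis unfolding 2 using dir neq by (auto simp: attach_eq T_new T_old)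
    next
      case 3
      then have "T' q (Child a) = Some j \<longleftrightarrow> T q (Child a) = Some j"
        "T' j (Parent a) = Some q \<longleftrightarrow> T j (Parent a) = Some q" for a
        using free by (auto simp: attach_eq)
      then show ?thesis using dual by simp
    qed
  qed
  have in_V': "T' q u = Some j \<Longrightarrow> q \<in> insert i V \<and> j \<in> insert i V \<and> u \<in> slots (\<delta> q)" for q u j
    using in_V old slots by (auto simp: attach_eq split: if_splits)
  have simple': "T' q u = Some j \<Longrightarrow> T' q v = Some j \<Longrightarrow> u = v" for q u v j
    using simple T_old by (auto simp: attach_eq split: if_splits)
  have conn': "(q, j) \<in> (adj T')\<^sup>*" if "q \<in> insert i V" "j \<in> insert i V" for q j
  proof -
    have "(q, j) \<in> (adj T')\<^sup>*" if "q \<in> V" "j \<in> V" for q j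
      using conn[OF that] rtrancl_mono[of "adj T" "adj T'"] by (auto simp: adj_attach)
    moreover have "(i, p) \<in> adj T'" "(p, i) \<in> adj T'" by (auto simp: adj_attach)
    ultimately have "(q, p) \<in> (adj T')\<^sup>*" "(p, j) \<in> (adj T')\<^sup>*"
      using that old by auto
    then show ?thesis by simp
  qed
  show ?thesis
    unfolding directed_tree_on_def
  proof (intro conjI)
    show "\<forall>q u j. T' q u = Some j \<longrightarrow> q \<in> insert i V \<and> j \<in> insert i V \<and> u \<in> slots (\<delta> q)"
      using in_V' by blast
    show "\<forall>q u v j. T' q u = Some j \<and> T' q v = Some j \<longrightarrow> u = v"
      using simple' by blast
    show "\<nexists>c. is_cycle T' c" using no_cycle by blast
  qed (use dual' conn' in \<open>blast+\<close>)
qed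

section \<open>Effect of the new leaf on subtrees\<close>

lemma subtree_attach_mono: "subtree T r u \<subseteq> subtree T' r u"
proof -
  have "T' r u = Some k" if "T r u = Some k" for k
    using that T_new free by (auto simp: attach_eq)
  moreover have "{(a, b) \<in> adj T. a \<noteq> r \<and> b \<noteq> r}\<^sup>* \<subseteq> {(a, b) \<in> adj T'. a \<noteq> r \<and> b \<noteq> r}\<^sup>*"
    by (rule rtrancl_mono) (auto simp: adj_attach)
  ultimately show ?thesis by (auto simp: subtree_def)
qed

text \<open>The leaf \<open>i\<close> is entered only from \<open>p\<close>, so it joins exactly
  those old subtrees that can reach it through \<open>p\<close>. The newly filled slot is excluded,
  as it was empty before.\<close>

lemma subtree_attach_old:
  assumes "r \<in> V" "(r, u) \<noteq> (p, t)"
  shows "subtree T' r u \<subseteq> subtree T r u \<union> {j. j = i \<and> p \<in> subtree T r u}"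
proof
  fix j assume "j \<in> subtree T' r u"
  then obtain k where k: "T' r u = Some k" "(k, j) \<in> {(a, b) \<in> adj T'. a \<noteq> r \<and> b \<noteq> r}\<^sup>*"
    by (auto simp: subtree_def)
  have kT: "T r u = Some k" using k(1) assms new by (auto simp: attach_eq split: if_splits)
  from k(2) show "j \<in> subtree T r u \<union> {j. j = i \<and> p \<in> subtree T r u}"
  proof (induction rule: rtrancl_induct)
    case base
    show ?case using kT by (auto simp: subtree_def)
  next
    case (step y z)
    have "z \<in> subtree T r u" if "y \<in> subtree T r u" "(y, z) \<in> adj T"
      using that step.hyps(2) by (auto simp: subtree_def intro: rtrancl_into_rtrancl)
    moreover have "i \<notin> subtree T r u" using subtree_subset[OF tree] new by blast
    ultimately show ?case using step.IH step.hyps(2) by (auto simp: adj_attach adj_new)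
  qed
qed

lemma subtree_attach_old_slot: "subtree T' p t \<subseteq> {i}"
proof
  fix j assume "j \<in> subtree T' p t"
  then have "(i, j) \<in> {(a, b) \<in> adj T'. a \<noteq> p \<and> b \<noteq> p}\<^sup>*"
    using neq by (auto simp: subtree_def attach_eq)
  then show "j \<in> {i}"
    by (induction rule: rtrancl_induct) (auto simp: adj_attach adj_new)
qed

text \<open>At most the label \<open>i\<close> is added, and it is smaller than \<open>r\<close>.
  Hence later insertions do not disturb what the cubic vector counts at \<open>r\<close>.\<close>

lemma subtree_attach_old_above:
  assumes "r \<in> V" "i < r"
  shows "subtree T' r u \<inter> {r<..} = subtree T r u \<inter> {r<..}"
proof (cases "(r, u) = (p, t)")
  case True
  then show ?thesis using subtree_attach_old_slot assms subtree_None[of T p t, OF free] by auto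
next
  case False
  then show ?thesis using subtree_attach_old[OF assms(1) False] subtree_attach_mono[of r u] assms by auto
qed

text \<open>Deleting the leaf \<open>i\<close> leaves the old tree, which is connected.\<close>

lemma subtree_attach_new: "subtree T' i s = V"
proof
  show "subtree T' i s \<subseteq> V"
    using subtree_subset[OF directed_tree_attach] subtree_irrefl[OF directed_tree_attach] by blast
  show "V \<subseteq> subtree T' i s"
  proof
    fix j assume "j \<in> V"
    then have "(p, j) \<in> (adj T)\<^sup>*" using tree old unfolding directed_tree_on_def by blast
    moreover have "adj T \<subseteq> {(a, b) \<in> adj T'. a \<noteq> i \<and> b \<noteq> i}"
      by (auto simp: adj_attach adj_new)
    ultimately have "(p, j) \<in> {(a, b) \<in> adj T'. a \<noteq> i \<and> b \<noteq> i}\<^sup>*"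
      using rtrancl_mono by blast
    then show "j \<in> subtree T' i s" using neq by (auto simp: subtree_def attach_eq)
  qed
qed

lemma subtree_attach_new_other: "u \<noteq> s \<Longrightarrow> subtree T' i u = {}"
  by (simp add: subtree_None attach_eq)

end

section \<open>Permutrees with extreme cubic vectors\<close>

text \<open>The side on which a node receives larger labels, whence \<open>Right\<close> rather than \<open>Left\<close>.\<close>

definition main_side :: "(side \<Rightarrow> slot) \<Rightarrow> decoration \<Rightarrow> side" where
  "main_side c d = (if c Only \<in> slots d then Only else Right)"

text \<open>In each direction a node has either one neutral slot or a left-right pair; this replaces
  the case split on four decorations.\<close>

lemma slots_cases:
  assumes "c \<in> {Child, Parent}"
  obtains "c Only \<in> slots d" "c Left \<notin> slots d" "main_side c d = Only"
  | "c Left \<in> slots d" "c Right \<in> slots d" "main_side c d = Right"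
  using assms by (cases d) (auto simp: slots_def main_side_def)

text \<open>A label smaller than all of \<open>V\<close> may be attached to \<open>p\<close> through the slot \<open>c a\<close>.\<close>

definition left_open :: "nat set \<Rightarrow> (nat \<Rightarrow> decoration) \<Rightarrow> slotted_tree \<Rightarrow> (side \<Rightarrow> slot) \<Rightarrow> nat \<Rightarrow> side \<Rightarrow> bool"
  where "left_open V \<delta> T c p a \<longleftrightarrow> p \<in> V \<and> a \<in> {Only, Left} \<and> c a \<in> slots (\<delta> p) \<and> T p (c a) = None \<and>
    (\<forall>r\<in>V. \<forall>c'\<in>{Child, Parent}. p \<notin> subtree T r (c' Right))"

text \<open>A right subtree holds only labels larger than its base node, so the minimal label lies
  in none.\<close>

lemma left_open_min:
  assumes perm: "permutree_on V \<delta> T" and "c \<in> {Child, Parent}" "i \<in> V" "\<And>j. j \<in> V \<Longrightarrow> i \<le> j"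
    and "a \<in> {Only, Left}" "c a \<in> slots (\<delta> i)" "T i (c a) = None"
  shows "left_open V \<delta> T c i a"
proof -
  have "i \<notin> subtree T r (c' Right)" if "r \<in> V" "c' \<in> {Child, Parent}" for r c'
  proof
    assume "i \<in> subtree T r (c' Right)"
    then have "r < i" using perm that unfolding permutree_on_def by blast
    then show False using assms(4)[OF that(1)] by simp
  qed
  then show ?thesis using assms unfolding left_open_def by blast
qed

text \<open>The old tree lies in direction \<open>c\<close> of \<open>i\<close>, and
  \<open>c'\<close> is the opposite direction. To allow further insertions, an open slot must
  survive in both directions: for \<open>c'\<close> at \<open>i\<close> itself, for \<open>c\<close>
  at \<open>i\<close> or at the old node \<open>q\<close>.\<close>

lemma permutree_attach:
  assumes perm: "permutree_on V \<delta> T" and min: "\<And>j. j \<in> V \<Longrightarrow> i < j"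
    and cc: "(c, c') \<in> {(Child, Parent), (Parent, Child)}"
    and op: "left_open V \<delta> T c' p a" and oq: "left_open V \<delta> T c q b"
    and T'_def: "T' = attach i (c (main_side c (\<delta> i))) p (c' a) T"
  shows "permutree_on (insert i V) \<delta> T'"
    and "\<exists>a. left_open (insert i V) \<delta> T' c' i a"
    and "\<exists>q b. left_open (insert i V) \<delta> T' c q b"
    and "subtree T' i (c (main_side c (\<delta> i))) = V"
    and "subtree T' i (c' a') = {}"
    and "r \<in> V \<Longrightarrow> subtree T' r u \<inter> {r<..} = subtree T r u \<inter> {r<..}"
proof -
  let ?x = "main_side c (\<delta> i)"
  have c: "c \<in> {Child, Parent}" and c': "c' \<in> {Child, Parent}" using cc by auto
  have inj: "\<And>a b. c a = c b \<longleftrightarrow> a = b" "\<And>a b. c' a \<noteq> c b" using cc by auto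
  have x: "?x \<in> {Only, Right}" by (simp add: main_side_def)
  have x_slot: "c ?x \<in> slots (\<delta> i)" by (rule slots_cases[OF c, of "\<delta> i"]) auto
  have i_new: "i \<notin> V" using min by blast
  interpret attachment V \<delta> T i p "c ?x" "c' a"
    using perm i_new op x_slot cc
    by unfold_locales (auto simp: permutree_on_def left_open_def)
  show sub_i: "subtree T' i (c ?x) = V" unfolding T'_def by (rule subtree_attach_new)
  have sub_i': "subtree T' i u = {}" if "u \<noteq> c ?x" for u
    unfolding T'_def using that by (rule subtree_attach_new_other)
  then show "subtree T' i (c' a') = {}" using inj by blast
  show "subtree T' r u \<inter> {r<..} = subtree T r u \<inter> {r<..}" if "r \<in> V" for r u
    unfolding T'_def using that min by (intro subtree_attach_old_above) auto
  have sub_left: "subtree T' r u \<subseteq> insert i (subtree T r u)" if "r \<in> V" for r u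
    using subtree_attach_old[OF that, of u] subtree_attach_old_slot unfolding T'_def by blast
  \<comment> \<open>The small label \<open>i\<close> would enter a right subtree only through
    \<open>p\<close>, which openness of \<open>p\<close> forbids.\<close>
  have sub_right: "subtree T' r (d Right) \<subseteq> subtree T r (d Right)" if "r \<in> V" "d \<in> {Child, Parent}" for r d
  proof -
    have "d Right \<noteq> c' a" using op c' that(2) by (auto simp: left_open_def)
    moreover have "p \<notin> subtree T r (d Right)" using op that by (auto simp: left_open_def)
    ultimately show ?thesis using subtree_attach_old[OF that(1), of "d Right"] unfolding T'_def by blast
  qed
  have left_i: "d Left \<noteq> c ?x" if "d \<in> {Child, Parent}" for d
    using x c that by auto
  have "subtree T' r (d Left) \<subseteq> {..<r} \<and> subtree T' r (d Right) \<subseteq> {r<..}"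
    if r: "r \<in> insert i V" and d: "d \<in> {Child, Parent}" for r d
  proof (cases "r = i")
    case True
    \<comment> \<open>All of \<open>V\<close> sits in one slot of \<open>i\<close>, which is never a
      left one, and \<open>V\<close> has only labels larger than \<open>i\<close>.\<close>
    have "subtree T' i (d Left) = {}" using sub_i' left_i[OF d] by blast
    moreover have "subtree T' i (d Right) \<subseteq> V" using sub_i sub_i' by (cases "d Right = c ?x") auto
    ultimately show ?thesis using True min by auto
  next
    case False
    then have rV: "r \<in> V" using r by auto
    have "subtree T r (d Left) \<subseteq> {..<r} \<and> subtree T r (d Right) \<subseteq> {r<..}"
      using perm rV d unfolding permutree_on_def by blast
    then show ?thesis using sub_left[OF rV, of "d Left"] sub_right[OF rV d] min[OF rV] by auto
  qed
  then show perm': "permutree_on (insert i V) \<delta> T'"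
    using directed_tree_attach unfolding permutree_on_def T'_def by blast
  have empty_i: "T' i u = None" if "u \<noteq> c ?x" for u
    using that unfolding T'_def by (simp add: attach_eq)
  have i_min: "\<And>j. j \<in> insert i V \<Longrightarrow> i \<le> j" using min by fastforce
  show "\<exists>a. left_open (insert i V) \<delta> T' c' i a"
  proof (rule slots_cases[OF c', of "\<delta> i"])
    assume "c' Only \<in> slots (\<delta> i)"
    then show ?thesis using left_open_min[OF perm' c' _ i_min] empty_i inj by blast
  next
    assume "c' Left \<in> slots (\<delta> i)"
    then show ?thesis using left_open_min[OF perm' c' _ i_min] empty_i inj by blast
  qed
  show "\<exists>q b. left_open (insert i V) \<delta> T' c q b"
  proof (rule slots_cases[OF c, of "\<delta> i"])
    \<comment> \<open>The single \<open>c\<close> slot of \<open>i\<close> is used up, but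
      \<open>V\<close> is then in no right subtree of \<open>i\<close>, so \<open>q\<close> stays
      open.\<close>
    assume only: "?x = Only"
    have "q \<noteq> i" using oq i_new by (auto simp: left_open_def)
    \<comment> \<open>This holds even for \<open>q = p\<close>, since the newly filled slot has the
      opposite direction.\<close>
    moreover have "T' q (c b) = None"
      using oq \<open>q \<noteq> i\<close> inj(2)[of a b] unfolding T'_def by (auto simp: attach_eq left_open_def)
    moreover have "q \<notin> subtree T' r (d Right)" if "r \<in> insert i V" "d \<in> {Child, Parent}" for r d
    proof (cases "r = i")
      case True
      have "d Right \<noteq> c ?x" using only that c by auto
      then show ?thesis using sub_i' True by blast
    next
      case False
      then have "r \<in> V" using that by auto
      then show ?thesis using sub_right[OF _ that(2), of r] oq that(2) unfolding left_open_def by blast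
    qed
    ultimately have "left_open (insert i V) \<delta> T' c q b" using oq unfolding left_open_def by blast
    then show ?thesis by blast
  next
    \<comment> \<open>Now \<open>q\<close> lies in the right subtree of \<open>i\<close> and is no
      longer open; the free left slot of \<open>i\<close> takes over.\<close>
    assume "c Left \<in> slots (\<delta> i)" "?x = Right"
    then have "left_open (insert i V) \<delta> T' c i Left"
      by (intro left_open_min[OF perm' c _ i_min]) (auto simp: empty_i inj)
    then show ?thesis by blast
  qed
qed

lemma permutree_singleton: "permutree_on {m} \<delta> (\<lambda>_ _. None)"
proof -
  have "\<not> is_cycle (\<lambda>_ _. None) c" for c
    unfolding is_cycle_def adj_def by fastforce
  then show ?thesis
    by (auto simp: permutree_on_def directed_tree_on_def subtree_None)
qed

section \<open>Permutrees for the vertices of the box\<close>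

definition right_desc :: "(nat \<Rightarrow> decoration) \<Rightarrow> slotted_tree \<Rightarrow> nat \<Rightarrow> nat set" where
  "right_desc \<delta> T i = subtree T i (Child (main_side Child (\<delta> i))) \<inter> {i<..}"

text \<open>For a single child slot, the cut with \<open>{i<..}\<close> is the condition
  \<open>i < j\<close> of \<open>cubic_set\<close>; for two, the right subtree satisfies it
  already.\<close>

lemma cubic_set_eq_right_desc:
  assumes "permutree_on {1..n} \<delta> T" "i \<in> {1..n}"
  shows "cubic_set n \<delta> T `` {i} = right_desc \<delta> T i"
proof -
  have "subtree T i (Child Right) \<subseteq> {i<..}" using assms unfolding permutree_on_def by blast
  then show ?thesis using assms(2)
    by (cases "\<delta> i") (auto simp: cubic_set_def right_desc_def main_side_def slots_def)
qed

lemma extreme_permutree: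
  assumes "n \<ge> 1"
  obtains T where "permutree_on {1..n} \<delta> T"
    and "\<And>i. i \<in> {1..n} \<Longrightarrow> right_desc \<delta> T i = (if i \<in> S then {i<..n} else {})"
proof -
  \<comment> \<open>Open slots in both directions belong to the invariant because the next label may
    need either one, depending on \<open>S\<close>.\<close>
  define good where "good m T \<longleftrightarrow> permutree_on {m..n} \<delta> T \<and>
      (\<forall>c\<in>{Child, Parent}. \<exists>p a. left_open {m..n} \<delta> T c p a) \<and>
      (\<forall>i\<in>{m..n}. right_desc \<delta> T i = (if i \<in> S then {i<..n} else {}))" for m T
  have "\<exists>T. good 1 T"
    using assms
  proof (induction rule: inc_induct)
    case base
    have open': "left_open {n} \<delta> (\<lambda>_ _. None) c n a"
      if "c \<in> {Child, Parent}" "a \<in> {Only, Left}" "c a \<in> slots (\<delta> n)" for c a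
      using that by (intro left_open_min permutree_singleton) auto
    have "\<exists>p a. left_open {n} \<delta> (\<lambda>_ _. None) c p a" if c: "c \<in> {Child, Parent}" for c
      by (rule slots_cases[OF c, of "\<delta> n"]) (use open'[OF c] in blast)+
    \<comment> \<open>Membership of \<open>n\<close> in \<open>S\<close> is irrelevant here, as
      \<open>{n<..n}\<close> is empty.\<close>
    then have "good n (\<lambda>_ _. None)"
      by (auto simp: good_def permutree_singleton right_desc_def subtree_None)
    then show ?case by blast
  next
    case (step m)
    then obtain T where T: "good (Suc m) T" by blast
    \<comment> \<open>Below \<open>m\<close>, all larger labels become descendants; above it, its
      child slots all stay empty.\<close>
    define c where "c = (if m \<in> S then Child else Parent)"
    define c' where "c' = (if m \<in> S then Parent else Child)"
    have cc: "(c, c') \<in> {(Child, Parent), (Parent, Child)}" by (simp add: c_def c'_def)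
    obtain p a where op: "left_open {Suc m..n} \<delta> T c' p a"
      using T unfolding good_def c'_def by fastforce
    obtain q b where oq: "left_open {Suc m..n} \<delta> T c q b"
      using T unfolding good_def c_def by fastforce
    define T' where "T' = attach m (c (main_side c (\<delta> m))) p (c' a) T"
    have perm: "permutree_on {Suc m..n} \<delta> T" using T by (simp add: good_def)
    have V: "insert m {Suc m..n} = {m..n}" using step.hyps by auto
    note att = permutree_attach[OF perm _ cc op oq T'_def, unfolded V]
    have "right_desc \<delta> T' i = (if i \<in> S then {i<..n} else {})" if "i \<in> {m..n}" for i
    proof (cases "i = m")
      case True
      then show ?thesis using att(4,5) by (auto simp: right_desc_def c_def c'_def)
    next
      case False
      then have i: "i \<in> {Suc m..n}" using that by auto
      then have "right_desc \<delta> T' i = right_desc \<delta> T i" using att(6) by (auto simp: right_desc_def)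
      then show ?thesis using T i by (simp add: good_def)
    qed
    moreover have "\<exists>p a. left_open {m..n} \<delta> T' d p a" if "d \<in> {Child, Parent}" for d
    proof -
      have "d = c \<or> d = c'" using that cc by auto
      then show ?thesis using att(2,3) by auto
    qed
    ultimately have "good m T'" using att(1) by (auto simp: good_def)
    then show ?case by blast
  qed
  then show ?thesis using that by (auto simp: good_def)
qed

section \<open>Diagonal maps and the normal fan of the cube\<close>

definition diag :: "real ^ 'm \<Rightarrow> real ^ 'm \<Rightarrow> real ^ 'm::finite" where
  "diag b x = (\<chi> k. b $ k * x $ k)"

lemma diag_nth [simp]: "diag b x $ k = b $ k * x $ k"
  by (simp add: diag_def)

lemma linear_diag: "linear (diag b)"
  by (rule linearI) (auto simp: vec_eq_iff algebra_simps)

lemma inner_diag: "u \<bullet> diag b x = diag b u \<bullet> x"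
  by (simp add: inner_vec_def algebra_simps)

text \<open>A linear functional is a sum of functions of one coordinate each, so over a product of
  intervals it is maximized coordinate by coordinate.\<close>

lemma maximal_on_unit_cube:
  fixes u x :: "real ^ 'm::finite"
  assumes "x \<in> cbox 0 1"
  shows "(\<forall>y\<in>cbox 0 1. u \<bullet> y \<le> u \<bullet> x) \<longleftrightarrow> (\<forall>k. \<forall>t\<in>{0..1}. u $ k * t \<le> u $ k * x $ k)"
proof (intro iffI allI ballI)
  fix k and t :: real
  assume max: "\<forall>y\<in>cbox 0 1. u \<bullet> y \<le> u \<bullet> x" and t: "t \<in> {0..1}"
  \<comment> \<open>The point \<open>x\<close> with its \<open>k\<close>-th coordinate replaced by
    \<open>t\<close>.\<close>
  define y :: "real ^ 'm" where "y = x + axis k (t - x $ k)"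
  have "y $ j = (if j = k then t else x $ j)" for j by (simp add: y_def axis_def)
  then have "y \<in> cbox 0 1" using assms t by (auto simp: mem_box_cart)
  then have "u \<bullet> y \<le> u \<bullet> x" using max by blast
  then show "u $ k * t \<le> u $ k * x $ k"
    by (simp add: y_def inner_add_right inner_axis algebra_simps)
next
  fix y :: "real ^ 'm"
  assume "\<forall>k. \<forall>t\<in>{0..1}. u $ k * t \<le> u $ k * x $ k" "y \<in> cbox 0 1"
  then show "u \<bullet> y \<le> u \<bullet> x"
    unfolding inner_vec_def by (intro sum_mono) (auto simp: mem_box_cart)
qed

text \<open>As \<open>diag b\<close> is self-adjoint, it can be moved to \<open>u\<close>. The
  coordinatewise maximality conditions on the cube then differ only by the positive factors
  \<open>b $ k\<close>, which cancel.\<close>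

lemma normal_cone_diag:
  fixes b :: "real ^ 'm::finite"
  assumes b: "\<And>k. b $ k > 0" and F: "F \<subseteq> cbox 0 1"
  shows "normal_cone (diag b ` cbox 0 1) (diag b ` F) = normal_cone (cbox 0 1) F"
proof -
  have "(\<forall>y\<in>cbox 0 1. diag b u \<bullet> y \<le> diag b u \<bullet> x) \<longleftrightarrow> (\<forall>y\<in>cbox 0 1. u \<bullet> y \<le> u \<bullet> x)"
    if "x \<in> F" for u x
  proof -
    have x: "x \<in> cbox 0 1" using that F by blast
    have "diag b u $ k * t \<le> diag b u $ k * x $ k \<longleftrightarrow> u $ k * t \<le> u $ k * x $ k" for k t
      using b[of k] by (simp add: mult.assoc)
    then show ?thesis by (simp only: maximal_on_unit_cube[OF x])
  qed
  then show ?thesis by (simp add: normal_cone_def inner_diag)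
qed

text \<open>An injective linear map matches the faces of the cube with those of its image, and
  matching faces have equal normal cones.\<close>

lemma normal_fan_diag:
  fixes b :: "real ^ 'm::finite"
  assumes b: "\<And>k. b $ k > 0"
  shows "normal_fan (diag b ` cbox 0 1) = normal_fan (cbox 0 1)"
proof -
  have "b $ k \<noteq> 0" for k using b[of k] by simp
  then have inj: "inj (diag b)" by (intro injI) (simp add: vec_eq_iff)
  have face: "diag b ` F face_of diag b ` cbox 0 1 \<longleftrightarrow> F face_of cbox 0 1" for F
    by (rule face_of_linear_image[OF linear_diag inj])
  have "normal_fan (diag b ` cbox 0 1) =
      {normal_cone (diag b ` cbox 0 1) (diag b ` F) | F. F face_of cbox 0 1 \<and> F \<noteq> {}}"
    unfolding normal_fan_def
  proof (intro Collect_cong iffI; elim exE conjE)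
    fix N G assume N: "N = normal_cone (diag b ` cbox 0 1) G"
      and G: "G face_of diag b ` cbox 0 1" "G \<noteq> {}"
    obtain F where "G = diag b ` F" using face_of_imp_subset[OF G(1)] by (meson subset_imageE)
    then show "\<exists>F. N = normal_cone (diag b ` cbox 0 1) (diag b ` F) \<and> F face_of cbox 0 1 \<and> F \<noteq> {}"
      using N G face by auto
  next
    fix N F assume "N = normal_cone (diag b ` cbox 0 1) (diag b ` F)" "F face_of cbox 0 1" "F \<noteq> {}"
    then show "\<exists>G. N = normal_cone (diag b ` cbox 0 1) G \<and> G face_of diag b ` cbox 0 1 \<and> G \<noteq> {}"
      using face by blast
  qed
  also have "\<dots> = normal_fan (cbox 0 1)"
    unfolding normal_fan_def
    by (intro Collect_cong ex_cong1) (auto simp: normal_cone_diag[OF b face_of_imp_subset])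
  finally show ?thesis .
qed

text \<open>Carries the description of the cube by its vertices from \<open>Basis\<close> over to
  coordinates.\<close>

lemma unit_cube_cart_convex_hull:
  "cbox (0 :: real ^ 'm::finite) 1 = convex hull {x. \<forall>k. x $ k = 0 \<or> x $ k = 1}"
proof -
  have "(One :: real ^ 'm) = 1"
    by (simp add: vec_eq_iff cart_eq_inner_axis inner_sum_left_Basis axis_in_Basis_iff) (simp add: inner_axis)
  moreover have "{x :: real ^ 'm. \<forall>i\<in>Basis. x \<bullet> i = 0 \<or> x \<bullet> i = 1} = {x. \<forall>k. x $ k = 0 \<or> x $ k = 1}"
    by (auto simp: Basis_vec_def inner_axis)
  ultimately show ?thesis using unit_interval_convex_hull[where 'a = "real ^ 'm"] by simp
qed

section \<open>The convex hull as a rescaled cube\<close>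

theorem theorem3p16:
  fixes n :: nat and \<delta> :: "nat \<Rightarrow> decoration" and idx :: "'m::finite \<Rightarrow> nat"
  assumes "n \<ge> 2"
    and "bij_betw idx UNIV {1..n - 1}"
  shows "normally_equivalent
           (convex hull (cubic_vector n \<delta> idx ` permutrees n \<delta>))
           (cbox (0 :: real ^ 'm) 1)"
proof -
  \<comment> \<open>The side lengths of the box: \<open>n - idx k\<close> labels exceed
    \<open>idx k\<close>, and there is at least one since \<open>idx k < n\<close>.\<close>
  define b :: "real ^ 'm" where "b = (\<chi> k. real (n - idx k))"
  have idx: "1 \<le> idx k" "idx k < n" for k
  proof -
    have "idx k \<in> {1..n - 1}" using bij_betwE[OF assms(2)] by blast
    then show "1 \<le> idx k" "idx k < n" using assms(1) by auto
  qed
  have b: "b $ k > 0" for k using idx by (simp add: b_def)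
  have coord: "cubic_vector n \<delta> idx T $ k = real (card (right_desc \<delta> T (idx k)))"
    if "permutree_on {1..n} \<delta> T" for T k
    using cubic_set_eq_right_desc[OF that, of "idx k"] idx[of k] by (simp add: cubic_vector_def)
  have "cubic_vector n \<delta> idx T \<in> diag b ` cbox 0 1" if "T \<in> permutrees n \<delta>" for T
  proof
    have perm: "permutree_on {1..n} \<delta> T" using that by (simp add: permutrees_def)
    define x where "x = (\<chi> k. cubic_vector n \<delta> idx T $ k / b $ k)"
    have "right_desc \<delta> T i \<subseteq> {i<..n}" for i
      using perm subtree_subset unfolding permutree_on_def right_desc_def by fastforce
    then have "card (right_desc \<delta> T i) \<le> n - i" for i
      using card_mono[of "{i<..n}"] by simp
    then have "cubic_vector n \<delta> idx T $ k \<le> b $ k" for k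
      by (simp add: coord[OF perm] b_def)
    then show "x \<in> cbox 0 1"
      using b by (auto simp: mem_box_cart x_def coord[OF perm] divide_le_eq less_imp_le)
    show "cubic_vector n \<delta> idx T = diag b x"
      using b by (simp add: vec_eq_iff x_def less_imp_neq[symmetric])
  qed
  then have "convex hull (cubic_vector n \<delta> idx ` permutrees n \<delta>) \<subseteq> diag b ` cbox 0 1"
    by (intro hull_minimal convex_linear_image[OF linear_diag] convex_box) auto
  moreover have "diag b x \<in> cubic_vector n \<delta> idx ` permutrees n \<delta>" if x: "\<forall>k. x $ k = 0 \<or> x $ k = 1" for x
  proof -
    \<comment> \<open>The vertex \<open>x\<close> prescribes \<open>S\<close>: the labels of the
      coordinates equal to 1.\<close>
    obtain T where perm: "permutree_on {1..n} \<delta> T"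
      and T: "\<And>i. i \<in> {1..n} \<Longrightarrow> right_desc \<delta> T i = (if i \<in> idx ` {k. x $ k = 1} then {i<..n} else {})"
      using extreme_permutree[of n \<delta> "idx ` {k. x $ k = 1}"] assms(1) by auto
    \<comment> \<open>Injectivity of \<open>idx\<close> lets the label determine the
      coordinate.\<close>
    have "idx k \<in> idx ` {k. x $ k = 1} \<longleftrightarrow> x $ k = 1" for k
      using assms(2) by (auto simp: bij_betw_def dest: injD)
    then have "diag b x $ k = cubic_vector n \<delta> idx T $ k" for k
      using x[rule_format, of k] T[of "idx k"] idx[of k] by (auto simp: coord[OF perm] b_def)
    then have "diag b x = cubic_vector n \<delta> idx T" by (simp add: vec_eq_iff)
    then show ?thesis using perm by (auto simp: permutrees_def)
  qed
  then have "diag b ` cbox 0 1 \<subseteq> convex hull (cubic_vector n \<delta> idx ` permutrees n \<delta>)"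
    unfolding unit_cube_cart_convex_hull convex_hull_linear_image[OF linear_diag]
    by (intro hull_mono) auto
  ultimately have "convex hull (cubic_vector n \<delta> idx ` permutrees n \<delta>) = diag b ` cbox 0 1" by blast
  then show ?thesis using normal_fan_diag[OF b] by (simp add: normally_equivalent_def)
qed

end
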